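(* Let $\Omega$ be a set and $\mathcal{B}$ a $\sigma$-algebra on $\Omega$. Suppose that $\mathcal{B}$ is finite and that $c$ is a 2-alternating capacity defined on $\mathcal{B}$. Let $F_1,\dots,F_n\in\mathcal{B}$ be such that $F_1\subset F_2\subset\cdots\subset F_n$. Then there exists a probability measure $P$ on $\mathcal{B}$ such that $P(F_i)=c(F_i)$ for all $i=1,\dots,n$ and $P\leq c$.
   Context: A set function $c:\mathcal{B}\to[0,1]$ is a capacity if $c(\Omega)=1$, $c(\emptyset)=0$, and $c(A)\leq c(B)$ for all $A,B\in\mathcal{B}$ with $A\subseteq B$. A capacity $c$ is 2-alternating if $c(A\cup B)+c(A\cap B)\leq c(A)+c(B)$ for all $A,B\in\mathcal{B}$. A capacity $c$ is called a probability measure if $c(A\cup B)+c(A\cap B)=c(A)+c(B)$ for all $A,B\in\mathcal{B}$. For capacities $c_1,c_2$ on $\mathcal{B}$, $c_1\leq c_2$ means $c_1(A)\leq c_2(A)$ for all $A\in\mathcal{B}$. The symbol $\subset$ denotes (not necessarily strict) inclusion. *)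

theory Defs
  imports "HOL-Analysis.Sigma_Algebra"
begin

text \<open>A set function on \<open>\<B>\<close> with values in \<open>[0,1]\<close> is represented by a total function
  of type \<open>'a set \<Rightarrow> real\<close>; its values outside \<open>\<B>\<close> are irrelevant.\<close>

definition capacity :: "'a set \<Rightarrow> 'a set set \<Rightarrow> ('a set \<Rightarrow> real) \<Rightarrow> bool" where
  "capacity \<Omega> \<B> c \<longleftrightarrow>
     (\<forall>A\<in>\<B>. c A \<in> {0..1}) \<and> c \<Omega> = 1 \<and> c {} = 0 \<and>
     (\<forall>A\<in>\<B>. \<forall>B\<in>\<B>. A \<subseteq> B \<longrightarrow> c A \<le> c B)"

definition two_alternating :: "'a set set \<Rightarrow> ('a set \<Rightarrow> real) \<Rightarrow> bool" where
  "two_alternating \<B> c \<longleftrightarrow>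
     (\<forall>A\<in>\<B>. \<forall>B\<in>\<B>. c (A \<union> B) + c (A \<inter> B) \<le> c A + c B)"

text \<open>Probability measures are here modular capacities; no countable additivity is required.\<close>

definition probability_measure :: "'a set \<Rightarrow> 'a set set \<Rightarrow> ('a set \<Rightarrow> real) \<Rightarrow> bool" where
  "probability_measure \<Omega> \<B> P \<longleftrightarrow>
     capacity \<Omega> \<B> P \<and>
     (\<forall>A\<in>\<B>. \<forall>B\<in>\<B>. P (A \<union> B) + P (A \<inter> B) = P A + P B)"

definition capacity_le :: "'a set set \<Rightarrow> ('a set \<Rightarrow> real) \<Rightarrow> ('a set \<Rightarrow> real) \<Rightarrow> bool" where
  "capacity_le \<B> c1 c2 \<longleftrightarrow> (\<forall>A\<in>\<B>. c1 A \<le> c2 A)"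

end

theory Submission
  imports Defs
begin

text \<open>For \<open>G \<in> \<B>\<close> replace \<open>c\<close> by \<open>A \<mapsto> c (A \<inter> G) + c (A \<union> G) - c G\<close>. This is again a
  2-alternating capacity, it lies below \<open>c\<close> precisely because \<open>c\<close> is 2-alternating, it is modular
  at \<open>G\<close>, and modularity of \<open>c\<close> at any other set is inherited. The value at \<open>H\<close> is unchanged
  if \<open>H\<close> is comparable with \<open>G\<close> or \<open>c\<close> is already modular at \<open>H\<close>. Performing the replacement first
  at the members of the chain and then at all members of the finite algebra therefore yields a
  probability measure below \<open>c\<close> that agrees with \<open>c\<close> on the chain.\<close>

definition modular_at :: "'a set set \<Rightarrow> ('a set \<Rightarrow> real) \<Rightarrow> 'a set \<Rightarrow> bool" where
  "modular_at \<B> c G \<longleftrightarrow> (\<forall>A\<in>\<B>. c (A \<inter> G) + c (A \<union> G) = c A + c G)"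

text \<open>The part of \<open>A\<close> inside \<open>G\<close> is measured by \<open>c\<close>,
  the part outside by the increment of \<open>c\<close> over \<open>G\<close>. Subtracting
  \<open>c G\<close> makes the value 0 at the empty set and 1 at \<open>\<Omega>\<close>.\<close>

definition split_at :: "('a set \<Rightarrow> real) \<Rightarrow> 'a set \<Rightarrow> 'a set \<Rightarrow> real" where
  "split_at c G A = c (A \<inter> G) + c (A \<union> G) - c G"

context algebra
begin

lemma capacity_split_at:
  assumes "capacity \<Omega> M c" and G: "G \<in> M"
  shows "capacity \<Omega> M (split_at c G)"
proof -
  have c: "c \<Omega> = 1" "c {} = 0" "\<And>A B. A \<in> M \<Longrightarrow> B \<in> M \<Longrightarrow> A \<subseteq> B \<Longrightarrow> c A \<le> c B"
    using assms(1) by (auto simp: capacity_def)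
  have sub: "G \<subseteq> \<Omega>"
    using G by (rule sets_into_space)
  have empty: "split_at c G {} = 0"
    using c by (simp add: split_at_def)
  have space: "split_at c G \<Omega> = 1"
    using c sub by (simp add: split_at_def Int_absorb1 Un_absorb2)
  have mono: "split_at c G A \<le> split_at c G B" if "A \<in> M" "B \<in> M" "A \<subseteq> B" for A B
  proof -
    have "c (A \<inter> G) \<le> c (B \<inter> G)" "c (A \<union> G) \<le> c (B \<union> G)"
      using that G by (auto intro!: c(3))
    then show ?thesis
      by (simp add: split_at_def)
  qed
  have "split_at c G A \<in> {0..1}" if "A \<in> M" for A
    using mono[of "{}" A] mono[of A \<Omega>] that sets_into_space[OF that] empty space by simp
  then show ?thesis
    using empty space mono by (simp add: capacity_def)
qed

text \<open>By distributivity, intersecting with \<open>G\<close> and uniting with \<open>G\<close>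
  both preserve unions and intersections, so each summand inherits the inequality.\<close>

lemma two_alternating_split_at:
  assumes "two_alternating M c" and G: "G \<in> M"
  shows "two_alternating M (split_at c G)"
  unfolding two_alternating_def
proof (intro ballI)
  fix A B assume A: "A \<in> M" and B: "B \<in> M"
  have c: "c (X \<union> Y) + c (X \<inter> Y) \<le> c X + c Y" if "X \<in> M" "Y \<in> M" for X Y
    using assms(1) that by (simp add: two_alternating_def)
  have "c ((A \<union> B) \<inter> G) + c ((A \<inter> B) \<inter> G) \<le> c (A \<inter> G) + c (B \<inter> G)"
  proof -
    have eqs: "(A \<inter> G) \<union> (B \<inter> G) = (A \<union> B) \<inter> G" "(A \<inter> G) \<inter> (B \<inter> G) = (A \<inter> B) \<inter> G"
      by auto
    show ?thesis
      using c[OF Int[OF A G] Int[OF B G]] by (simp only: eqs)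
  qed
  moreover have "c ((A \<union> B) \<union> G) + c ((A \<inter> B) \<union> G) \<le> c (A \<union> G) + c (B \<union> G)"
  proof -
    have eqs: "(A \<union> G) \<union> (B \<union> G) = (A \<union> B) \<union> G" "(A \<union> G) \<inter> (B \<union> G) = (A \<inter> B) \<union> G"
      by auto
    show ?thesis
      using c[OF Un[OF A G] Un[OF B G]] by (simp only: eqs)
  qed
  ultimately show "split_at c G (A \<union> B) + split_at c G (A \<inter> B) \<le> split_at c G A + split_at c G B"
    by (simp add: split_at_def)
qed

lemma split_at_le:
  assumes "two_alternating M c" "G \<in> M"
  shows "capacity_le M (split_at c G) c"
  unfolding capacity_le_def
proof
  fix A assume "A \<in> M"
  then have "c (A \<union> G) + c (A \<inter> G) \<le> c A + c G"
    using assms by (simp add: two_alternating_def)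
  then show "split_at c G A \<le> c A"
    by (simp add: split_at_def)
qed

text \<open>By absorption, the new function agrees with \<open>c\<close> at
  \<open>A \<inter> G\<close>, \<open>A \<union> G\<close> and \<open>G\<close>, so the claim is
  just the defining formula.\<close>

lemma modular_at_split_at_same: "modular_at M (split_at c G) G"
proof -
  have "(A \<union> G) \<inter> G = G" "(A \<inter> G) \<union> G = G" for A :: "'a set"
    by auto
  then show ?thesis
    by (simp add: modular_at_def split_at_def)
qed

lemma modular_at_split_at:
  assumes "modular_at M c H" and G: "G \<in> M" and H: "H \<in> M"
  shows "modular_at M (split_at c G) H"
  unfolding modular_at_def
proof
  fix A assume A: "A \<in> M"
  have c: "c (X \<inter> H) + c (X \<union> H) = c X + c H" if "X \<in> M" for X
    using assms(1) that by (simp add: modular_at_def)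
  \<comment> \<open>The sets \<open>A \<inter> G\<close> and
    \<open>(A \<union> H) \<inter> G\<close> have the same union with \<open>H\<close>; subtracting
    their two modularity equations cancels it.\<close>
  have "c ((A \<inter> H) \<inter> G) + c ((A \<union> H) \<inter> G) = c (A \<inter> G) + c (H \<inter> G)"
  proof -
    have eqs: "((A \<union> H) \<inter> G) \<inter> H = H \<inter> G" "((A \<union> H) \<inter> G) \<union> H = (A \<inter> G) \<union> H"
      "(A \<inter> G) \<inter> H = (A \<inter> H) \<inter> G"
      by auto
    show ?thesis
      using c[OF Int[OF A G], unfolded eqs(3)] c[OF Int[OF Un[OF A H] G], unfolded eqs(1,2)]
      by linarith
  qed
  \<comment> \<open>Dually, \<open>A \<union> G\<close> and \<open>(A \<inter> H) \<union> G\<close>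
    have the same intersection with \<open>H\<close>.\<close>
  moreover have "c ((A \<inter> H) \<union> G) + c ((A \<union> H) \<union> G) = c (A \<union> G) + c (H \<union> G)"
  proof -
    have eqs: "((A \<inter> H) \<union> G) \<union> H = H \<union> G" "((A \<inter> H) \<union> G) \<inter> H = (A \<union> G) \<inter> H"
      "(A \<union> G) \<union> H = (A \<union> H) \<union> G"
      by auto
    show ?thesis
      using c[OF Un[OF A G], unfolded eqs(3)] c[OF Un[OF Int[OF A H] G], unfolded eqs(1,2)]
      by linarith
  qed
  ultimately show "split_at c G (A \<inter> H) + split_at c G (A \<union> H) = split_at c G A + split_at c G H"
    by (simp add: split_at_def)
qed

text \<open>If \<open>H\<close> and \<open>G\<close> are comparable, one of the two summands is
  \<open>c G\<close> and cancels. Otherwise the claim is modularity at \<open>H\<close>, tested on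
  the set \<open>G\<close>.\<close>

lemma split_at_eq:
  assumes "G \<in> M" "H \<subseteq> G \<or> G \<subseteq> H \<or> modular_at M c H"
  shows "split_at c G H = c H"
proof -
  consider "H \<subseteq> G" | "G \<subseteq> H" | "modular_at M c H"
    using assms(2) by blast
  then show ?thesis
  proof cases
    case 3
    then have "c (G \<inter> H) + c (G \<union> H) = c G + c H"
      using assms(1) by (simp add: modular_at_def)
    then show ?thesis
      by (simp add: split_at_def Int_commute Un_commute)
  qed (simp_all add: split_at_def Int_absorb1 Int_absorb2 Un_absorb1 Un_absorb2)
qed

text \<open>\<open>T\<close> lists the sets to be made modular, \<open>K\<close> those whose values
  are protected. The disjunction in the last assumption serves both passes: comparability for the
  chain, modularity afterwards.\<close>

lemma ex_modular_at_minorant: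
  assumes "finite T" "T \<subseteq> M" "K \<subseteq> M" and c: "capacity \<Omega> M c" "two_alternating M c"
    and "\<And>G H. G \<in> T \<Longrightarrow> H \<in> K \<Longrightarrow> H \<subseteq> G \<or> G \<subseteq> H \<or> modular_at M c H"
  shows "\<exists>d. capacity \<Omega> M d \<and> two_alternating M d \<and> capacity_le M d c \<and>
             (\<forall>H\<in>K. d H = c H) \<and> (\<forall>G\<in>M. G \<in> T \<or> modular_at M c G \<longrightarrow> modular_at M d G)"
  using assms(1,2,6)
proof (induction T)
  case empty
  then show ?case
    using c by (intro exI[of _ c]) (simp add: capacity_le_def)
next
  case (insert G T)
  then obtain d where d: "capacity \<Omega> M d" "two_alternating M d" "capacity_le M d c"
      "\<forall>H\<in>K. d H = c H" "\<forall>G\<in>M. G \<in> T \<or> modular_at M c G \<longrightarrow> modular_at M d G"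
    by auto
  have G: "G \<in> M"
    using insert.prems by simp
  have "split_at d G H = c H" if "H \<in> K" for H
  proof -
    \<comment> \<open>Modularity of \<open>c\<close> at \<open>H\<close> has survived the earlier
      replacements, so it is available for \<open>d\<close>.\<close>
    have "H \<subseteq> G \<or> G \<subseteq> H \<or> modular_at M d H"
      using insert.prems(2)[of G H] d(5) assms(3) that by blast
    then show ?thesis
      using split_at_eq[OF G] d(4) that by simp
  qed
  moreover have "capacity_le M (split_at d G) c"
    using split_at_le[OF d(2) G] d(3) by (auto simp: capacity_le_def intro: order_trans)
  moreover have "modular_at M (split_at d G) H"
    if "H \<in> M" "H \<in> insert G T \<or> modular_at M c H" for H
    using that d(5) modular_at_split_at[OF _ G] modular_at_split_at_same by blast
  ultimately show ?case
    using capacity_split_at[OF d(1) G] two_alternating_split_at[OF d(2) G] by blast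
qed

lemma ex_probability_measure_eq_on_chain:
  assumes "finite M" "capacity \<Omega> M c" "two_alternating M c" "K \<subseteq> M"
    and chain: "\<And>G H. G \<in> K \<Longrightarrow> H \<in> K \<Longrightarrow> G \<subseteq> H \<or> H \<subseteq> G"
  shows "\<exists>P. probability_measure \<Omega> M P \<and> (\<forall>H\<in>K. P H = c H) \<and> capacity_le M P c"
proof -
  have "finite K"
    using assms(1,4) by (rule rev_finite_subset)
  moreover have "H \<subseteq> G \<or> G \<subseteq> H \<or> modular_at M c H" if "G \<in> K" "H \<in> K" for G H
    using chain[OF that] by auto
  \<comment> \<open>First pass, with \<open>T = K\<close>: the chain protects its own
    values.\<close>
  ultimately have "\<exists>d. capacity \<Omega> M d \<and> two_alternating M d \<and> capacity_le M d c \<and>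
      (\<forall>H\<in>K. d H = c H) \<and> (\<forall>G\<in>M. G \<in> K \<or> modular_at M c G \<longrightarrow> modular_at M d G)"
    using assms(2-4) by (intro ex_modular_at_minorant)
  then obtain d where d: "capacity \<Omega> M d" "two_alternating M d" "capacity_le M d c"
      "\<forall>H\<in>K. d H = c H" "\<forall>G\<in>M. G \<in> K \<or> modular_at M c G \<longrightarrow> modular_at M d G"
    by (elim exE conjE)
  \<comment> \<open>Second pass, with \<open>T = M\<close>: a \<open>G\<close> in \<open>M\<close>
    may be incomparable with members of \<open>K\<close>, but \<open>d\<close> is already modular at
    those.\<close>
  have "H \<subseteq> G \<or> G \<subseteq> H \<or> modular_at M d H" if "H \<in> K" for G H
    using d(5) that assms(4) by auto
  then have "\<exists>P. capacity \<Omega> M P \<and> two_alternating M P \<and> capacity_le M P d \<and>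
      (\<forall>H\<in>K. P H = d H) \<and> (\<forall>G\<in>M. G \<in> M \<or> modular_at M d G \<longrightarrow> modular_at M P G)"
    using assms(1,4) d(1,2) by (intro ex_modular_at_minorant subset_refl)
  then obtain P where P: "capacity \<Omega> M P" "capacity_le M P d"
      "\<forall>H\<in>K. P H = d H" "\<forall>G\<in>M. G \<in> M \<or> modular_at M d G \<longrightarrow> modular_at M P G"
    by (elim exE conjE)
  \<comment> \<open>Modularity at every member of \<open>M\<close> is the additivity required of a
    probability measure.\<close>
  have "probability_measure \<Omega> M P"
    using P(1,4) by (simp add: probability_measure_def modular_at_def add.commute)
  moreover have "capacity_le M P c"
    using P(2) d(3) by (auto simp: capacity_le_def intro: order_trans)
  ultimately show ?thesis
    using P(3) d(4) by auto
qed

end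

theorem theorem2p2:
  fixes \<Omega> :: "'a set" and \<B> :: "'a set set"
    and c :: "'a set \<Rightarrow> real" and n :: nat and F :: "nat \<Rightarrow> 'a set"
  assumes "sigma_algebra \<Omega> \<B>"
    and "finite \<B>"
    and "capacity \<Omega> \<B> c"
    and "two_alternating \<B> c"
    and "\<forall>i\<in>{1..n}. F i \<in> \<B>"
    and "\<forall>i\<in>{1..<n}. F i \<subseteq> F (Suc i)"
  shows "\<exists>P. probability_measure \<Omega> \<B> P \<and> (\<forall>i\<in>{1..n}. P (F i) = c (F i)) \<and> capacity_le \<B> P c"
proof -
  interpret sigma_algebra \<Omega> \<B>
    by fact
  have mono: "F i \<subseteq> F j" if "i \<le> j" "1 \<le> i" "j \<le> n" for i j
    using that
  proof (induction j rule: dec_induct)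
    case (step k)
    then have "F i \<subseteq> F k" "F k \<subseteq> F (Suc k)"
      using assms(6) by auto
    then show ?case
      by (rule subset_trans)
  qed simp
  \<comment> \<open>Comparing indices gives pairwise comparability; for \<open>n = 0\<close> the
    image is empty.\<close>
  have "G \<subseteq> H \<or> H \<subseteq> G" if GH: "G \<in> F ` {1..n}" "H \<in> F ` {1..n}" for G H
  proof -
    obtain i j where "G = F i" "H = F j" "i \<in> {1..n}" "j \<in> {1..n}"
      using GH by blast
    then show ?thesis
      using mono[of i j] mono[of j i] by (cases "i \<le> j") auto
  qed
  moreover have "F ` {1..n} \<subseteq> \<B>"
    using assms(5) by blast
  ultimately show ?thesis
    using ex_probability_measure_eq_on_chain[OF assms(2-4), of "F ` {1..n}"] by simp
qed

end
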